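(* Let $\alpha>0$, $K_\Sigma>0$. Let $u$ be a function whose Fourier transform $\phi_u$ is symmetric ($\phi_u(-t)=\phi_u(t)$), real-valued, continuous in some neighbourhood of zero and supported on $[-1,1]$, and suppose that $$\int_{-1}^1\phi_u(t)\,dt=2,\qquad \left|\frac{\phi_u(t)}{|t|^{\alpha}}\right|\le U\quad\text{for all }t\in\mathbb R,$$ where $U>0$ is a constant and at $t=0$ the ratio is defined as $\lim_{t\to0}\phi_u(t)|t|^{-\alpha}$, which is assumed to exist. Let $p_{ng_n}$ be the estimator defined in the context. (i) Suppose $\phi_Z(t)\ne0$ for all $t\in\mathbb R$, $\phi_Z$ is integrable, and there are constants $d_0,\beta>0$ such that $d_0|t|^{-\beta}\le|\phi_Z(t)|$ for all $|t|$ sufficiently large. If $g_n=d\,n^{-1/(2\alpha+2\beta)}$ for some constant $d>0$, then $$\sup_{f\in\Sigma(\alpha,K_\Sigma),\,p\in[0,1)}\mathbb E_{p,f}\big[(p_{ng_n}-p)^2\big]\lesssim n^{-(2\alpha+1)/(2\alpha+2\beta)}.$$ (ii) Suppose $\phi_Z(t)\ne0$ for all $t\in\mathbb R$, $\phi_Z$ is integrable, and there are constants $\beta_0\in\mathbb R$ and $d_0,\beta,\gamma>0$ such that $d_0|t|^{\beta_0}e^{-|t|^{\beta}/\gamma}\le|\phi_Z(t)|$ for all $|t|$ sufficiently large. If $g_n=(4/\gamma)^{1/\beta}(\log n)^{-1/\beta}$ ($n\ge2$), then $$\sup_{f\in\Sigma(\alpha,K_\Sigma),\,p\in[0,1)}\mathbb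 E_{p,f}\big[(p_{ng_n}-p)^2\big]\lesssim(\log n)^{-(2\alpha+1)/\beta}.$$
   Context: Model: $X_1,\dots,X_n$ are i.i.d. copies of $X=Y+Z$, where $Y$ and $Z$ are independent, $Y=AV$ with $A$ and $V$ independent, $A$ Bernoulli with $P(A=1)=1-p$, $V$ has probability density $f$ on $\mathbb R$, and $Z$ has a known distribution with density $k$. Thus $\phi_X(t)=(p+(1-p)\phi_f(t))\phi_Z(t)$. $\mathbb E_{p,f}$ denotes expectation under the parameter $(p,f)$. $\phi_\xi$ is the characteristic function of a random variable $\xi$ and $\phi_g(t)=\int_{-\infty}^\infty e^{itx}g(x)\,dx$ is the Fourier transform of a function $g$. Class of densities: $\Sigma(\alpha,K_\Sigma)=\{f \text{ probability density}:\int_{-\infty}^\infty|\phi_f(t)|^2(1+|t|^{2\alpha})\,dt\le K_\Sigma\}$. Estimator: for a bandwidth $g_n>0$, $$p_{ng_n}=\frac{g_n}{2}\int_{-1/g_n}^{1/g_n}\frac{\phi_{emp}(t)\phi_u(g_nt)}{\phi_Z(t)}\,dt,\qquad \phi_{emp}(t)=\frac1n\sum_{j=1}^ne^{itX_j}.$$ $a_n\lesssim b_n$ means $a_n\le C b_n$ for all $n$ (for which the quantities are defined), with a constant $C$ not depending on $n$. *)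

theory Defs
  imports "HOL-Probability.Probability"
begin

definition prob_density :: "(real \<Rightarrow> real) \<Rightarrow> bool" where
  "prob_density f \<longleftrightarrow> f \<in> borel_measurable borel \<and> (\<forall>x. 0 \<le> f x) \<and>
     (\<integral>\<^sup>+x. ennreal (f x) \<partial>lborel) = 1"

definition fourier :: "(real \<Rightarrow> complex) \<Rightarrow> real \<Rightarrow> complex" where
  "fourier h t = (LINT x|lborel. iexp (t * x) * h x)"

text \<open>
  A transform that is only required to be continuous near zero need not be the transform of an
  integrable function. The function \<open>\<phi>\<close> is therefore a Fourier transform of \<open>u\<close> either through
  the absolutely convergent integral or in the sense of Plancherel, that is as the limit in mean
  square of the truncated integrals; in the latter case \<open>\<phi>\<close> is some pointwise representative.
\<close>

definition is_fourier_transform :: "(real \<Rightarrow> complex) \<Rightarrow> (real \<Rightarrow> complex) \<Rightarrow> bool" where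
  "is_fourier_transform u \<phi> \<longleftrightarrow>
     (integrable lborel u \<and> (\<forall>t. \<phi> t = fourier u t)) \<or>
     (u \<in> borel_measurable borel \<and> integrable lborel (\<lambda>x. (cmod (u x))\<^sup>2) \<and>
      \<phi> \<in> borel_measurable borel \<and> integrable lborel (\<lambda>t. (cmod (\<phi> t))\<^sup>2) \<and>
      ((\<lambda>R::real. \<integral>\<^sup>+t. ennreal ((cmod (fourier (\<lambda>x. indicator {-R..R} x * u x) t - \<phi> t))\<^sup>2)
          \<partial>lborel) \<longlongrightarrow> 0) at_top)"

definition Sobolev_class :: "real \<Rightarrow> real \<Rightarrow> (real \<Rightarrow> real) set" where
  "Sobolev_class \<alpha> K = {f. prob_density f \<and>
     (\<integral>\<^sup>+t. ennreal ((cmod (fourier (\<lambda>x. complex_of_real (f x)) t))\<^sup>2 * (1 + \<bar>t\<bar> powr (2 * \<alpha>)))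
        \<partial>lborel) \<le> ennreal K}"

text \<open>The law of \<open>X = A V + Z\<close>, realised on the product space of \<open>A\<close>, \<open>V\<close> and \<open>Z\<close>.\<close>

definition obs_law :: "(real \<Rightarrow> real) \<Rightarrow> real \<Rightarrow> (real \<Rightarrow> real) \<Rightarrow> real measure" where
  "obs_law k p f = distr
     (measure_pmf (bernoulli_pmf (1 - p)) \<Otimes>\<^sub>M (density lborel f \<Otimes>\<^sub>M density lborel k))
     borel (\<lambda>(a, v, z). of_bool a * v + z)"

definition sample_law :: "(real \<Rightarrow> real) \<Rightarrow> real \<Rightarrow> (real \<Rightarrow> real) \<Rightarrow> nat \<Rightarrow> (nat \<Rightarrow> real) measure" where
  "sample_law k p f n = (\<Pi>\<^sub>M j\<in>{1..n}. obs_law k p f)"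

definition emp_char :: "nat \<Rightarrow> (nat \<Rightarrow> real) \<Rightarrow> real \<Rightarrow> complex" where
  "emp_char n x t = (\<Sum>j=1..n. iexp (t * x j)) / of_nat n"

definition atom_estimator ::
    "(real \<Rightarrow> real) \<Rightarrow> (real \<Rightarrow> real) \<Rightarrow> nat \<Rightarrow> real \<Rightarrow> (nat \<Rightarrow> real) \<Rightarrow> complex" where
  "atom_estimator k \<phi>\<^sub>u n g x = of_real (g / 2) *
     (LINT t:{-1/g..1/g}|lborel.
        emp_char n x t * of_real (\<phi>\<^sub>u (g * t)) / char (density lborel k) t)"

text \<open>
  The estimator is real (\<open>atom_estimator_real\<close> below), so that the squared modulus is the square
  of the estimation error.
\<close>

definition mse ::
    "(real \<Rightarrow> real) \<Rightarrow> (real \<Rightarrow> real) \<Rightarrow> nat \<Rightarrow> real \<Rightarrow> real \<Rightarrow> (real \<Rightarrow> real) \<Rightarrow> ennreal" where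
  "mse k \<phi>\<^sub>u n g p f =
     (\<integral>\<^sup>+x. ennreal ((cmod (atom_estimator k \<phi>\<^sub>u n g x - of_real p))\<^sup>2) \<partial>sample_law k p f n)"

lemma prob_space_density_lborel:
  assumes "prob_density f"
  shows "prob_space (density lborel f)"
  using assms by (intro prob_spaceI) (auto simp: prob_density_def emeasure_density)

lemma prob_space_obs_law:
  assumes "prob_density f" "prob_density k"
  shows "prob_space (obs_law k p f)"
proof -
  interpret F: prob_space "density lborel f" by (rule prob_space_density_lborel) fact
  interpret K: prob_space "density lborel k" by (rule prob_space_density_lborel) fact
  interpret FK: pair_prob_space "density lborel f" "density lborel k" ..
  interpret B: pair_prob_space "measure_pmf (bernoulli_pmf (1 - p))"
    "density lborel f \<Otimes>\<^sub>M density lborel k" ..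
  show ?thesis
    unfolding obs_law_def by (rule B.prob_space_distr) measurable
qed

lemma atom_estimator_real:
  assumes "\<And>t. \<phi>\<^sub>u (-t) = \<phi>\<^sub>u t"
  shows "atom_estimator k \<phi>\<^sub>u n g x \<in> \<real>"
proof -
  define F where "F t = indicator {-1/g..1/g} t *\<^sub>R
    (emp_char n x t * of_real (\<phi>\<^sub>u (g * t)) / char (density lborel k) t)" for t
  have c: "char M (-t) = cnj (char M t)" for M :: "real measure" and t
    unfolding char_def by (simp add: exp_cnj flip: Bochner_Integration.integral_cnj)
  have e: "emp_char n x (-t) = cnj (emp_char n x t)" for t
    by (simp add: emp_char_def exp_cnj)
  have i: "indicator {-1/g..1/g} (-t) = (indicator {-1/g..1/g} t :: real)" for t
    by (auto simp: indicator_def)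
  have "F (-t) = cnj (F t)" for t
    using assms[of "g * t"] by (simp add: F_def c e i[simplified])
  then have "(LINT t|lborel. F t) = (LINT t|lborel. cnj (F t))"
    using lborel_integral_real_affine[of "-1" F 0] by simp
  then have "cnj (LINT t|lborel. F t) = (LINT t|lborel. F t)"
    by simp
  then have "(LINT t|lborel. F t) \<in> \<real>"
    by (simp add: Reals_cnj_iff)
  then show ?thesis
    unfolding atom_estimator_def set_lebesgue_integral_def F_def[symmetric]
    by (intro Reals_mult) auto
qed

end

theory Submission
  imports Defs
begin

text \<open>
  The estimator is an average of i.i.d. copies of \<open>w X\<close>, where \<open>w y\<close> is the integral of
  \<open>h t * iexp (t * y)\<close> and \<open>h t = (g / 2) * \<phi>\<^sub>u (g * t) / char Z t\<close> on \<open>[-1/g, 1/g]\<close>; hence the risk is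
  the squared bias plus \<open>1/n\<close> times the variance of \<open>w X\<close>. The factor \<open>char Z\<close> cancels in the bias,
  and Cauchy-Schwarz with \<open>\<bar>\<phi>\<^sub>u t\<bar> \<le> U * \<bar>t\<bar> powr \<alpha>\<close> and the Sobolev bound makes the squared bias
  \<open>O(g powr (2 * \<alpha> + 1))\<close>. The second moment of \<open>w X\<close> is the double integral of
  \<open>h t * cnj (h s) * char X (t - s)\<close>. Since \<open>\<bar>char X\<bar> \<le> \<bar>char Z\<bar>\<close> is integrable, the Schur test bounds
  it by the product of the integrals of \<open>\<bar>h\<bar>\<^sup>2\<close> and \<open>\<bar>char Z\<bar>\<close>, which avoids both Plancherel and the
  boundedness of the density of \<open>X\<close>. The lower bounds on \<open>\<bar>char Z\<bar>\<close> then balance the two terms.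
\<close>

section \<open>Second moments of sums of independent bounded terms\<close>

lemma integrable_square_sum_PiM:
  fixes v :: "'a \<Rightarrow> real" and c :: real
  assumes "prob_space M" and [measurable]: "v \<in> borel_measurable M"
    and bound: "\<And>y. \<bar>v y\<bar> \<le> B" and "finite J"
  shows "integrable (\<Pi>\<^sub>M i\<in>J. M) (\<lambda>x. (c + (\<Sum>i\<in>J. v (x i)))\<^sup>2)"
proof (rule finite_measure.integrable_const_bound[of _ _ "(\<bar>c\<bar> + real (card J) * B)\<^sup>2"])
  show "finite_measure (\<Pi>\<^sub>M i\<in>J. M)"
    using assms(1) by (intro prob_space.finite_measure prob_space_PiM)
  have "\<bar>c + (\<Sum>i\<in>J. v (x i))\<bar> \<le> \<bar>c\<bar> + real (card J) * B" for x
  proof -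
    have "\<bar>\<Sum>i\<in>J. v (x i)\<bar> \<le> (\<Sum>i\<in>J. B)"
      by (intro order_trans[OF sum_abs] sum_mono bound)
    then show ?thesis by simp
  qed
  then have "(c + (\<Sum>i\<in>J. v (x i)))\<^sup>2 \<le> (\<bar>c\<bar> + real (card J) * B)\<^sup>2" for x
    by (metis abs_ge_zero power2_abs power_mono)
  then show "AE x in (\<Pi>\<^sub>M i\<in>J. M). norm ((c + (\<Sum>i\<in>J. v (x i)))\<^sup>2) \<le> (\<bar>c\<bar> + real (card J) * B)\<^sup>2"
    by (auto simp: power_abs[symmetric])
  show "(\<lambda>x. (c + (\<Sum>i\<in>J. v (x i)))\<^sup>2) \<in> borel_measurable (\<Pi>\<^sub>M i\<in>J. M)"
    by measurable
qed

text \<open>Bias-variance decomposition: \<open>c\<close> plays the bias and the copies of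
  \<open>v\<close> the centred noise. The induction integrates out one coordinate at a time; the
  cross term vanishes because \<open>v\<close> has mean zero, so each coordinate adds exactly the
  second moment of \<open>v\<close>. Boundedness of \<open>v\<close> supplies every integrability
  condition.\<close>

lemma integral_square_sum_PiM:
  fixes v :: "'a \<Rightarrow> real" and c :: real
  assumes "prob_space M" and [measurable]: "v \<in> borel_measurable M"
    and bound: "\<And>y. \<bar>v y\<bar> \<le> B" and mean: "(LINT y|M. v y) = 0" and "finite I"
  shows "(LINT x|(\<Pi>\<^sub>M i\<in>I. M). (c + (\<Sum>i\<in>I. v (x i)))\<^sup>2) =
    c\<^sup>2 + real (card I) * (LINT y|M. (v y)\<^sup>2)"
  using \<open>finite I\<close>
proof (induction I)
  case empty
  interpret M: prob_space M by fact
  interpret P: product_prob_space "\<lambda>_::'b. M" ..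
  interpret E: prob_space "\<Pi>\<^sub>M i\<in>{}::'b set. M" by (rule prob_space_PiM) unfold_locales
  show ?case by (simp add: E.prob_space)
next
  case (insert i I)
  interpret M: prob_space M by fact
  interpret P: product_prob_space "\<lambda>_::'b. M" ..
  interpret E: prob_space "\<Pi>\<^sub>M i\<in>J. M" for J :: "'b set" by (rule prob_space_PiM) unfold_locales
  have int_v: "integrable M v" "integrable M (\<lambda>y. (v y)\<^sup>2)"
  proof -
    show "integrable M v" using bound by (intro M.integrable_const_bound[of _ B]) auto
    have "(v y)\<^sup>2 \<le> B\<^sup>2" for y using bound[of y] by (simp add: abs_le_square_iff[symmetric])
    then show "integrable M (\<lambda>y. (v y)\<^sup>2)" by (intro M.integrable_const_bound[of _ "B\<^sup>2"]) auto
  qed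
  note int_sum = integrable_square_sum_PiM[OF assms(1-3)]
  have inner: "(LINT y|M. (a + v y)\<^sup>2) = a\<^sup>2 + (LINT y|M. (v y)\<^sup>2)" for a
  proof -
    have "(LINT y|M. (a + v y)\<^sup>2) = (LINT y|M. a\<^sup>2 + ((v y)\<^sup>2 + 2 * a * v y))"
      by (simp add: power2_sum algebra_simps)
    also have "\<dots> = a\<^sup>2 + (LINT y|M. (v y)\<^sup>2)"
      using int_v mean by (simp add: M.prob_space)
    finally show ?thesis .
  qed
  have "(LINT x|(\<Pi>\<^sub>M i\<in>insert i I. M). (c + (\<Sum>i\<in>insert i I. v (x i)))\<^sup>2) =
    (LINT x|(\<Pi>\<^sub>M i\<in>I. M). LINT y|M. (c + (\<Sum>j\<in>insert i I. v ((x(i := y)) j)))\<^sup>2)"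
    using insert by (intro P.product_integral_insert int_sum) auto
  also have "\<dots> = (LINT x|(\<Pi>\<^sub>M i\<in>I. M). LINT y|M. ((c + (\<Sum>j\<in>I. v (x j))) + v y)\<^sup>2)"
  proof -
    have "(\<Sum>j\<in>I. v ((x(i := y)) j)) = (\<Sum>j\<in>I. v (x j))" for x y
      using insert by (intro sum.cong) auto
    then show ?thesis using insert by (simp add: algebra_simps)
  qed
  also have "\<dots> = c\<^sup>2 + real (card (insert i I)) * (LINT y|M. (v y)\<^sup>2)"
    unfolding inner using insert int_sum[OF insert.hyps(1)] by (simp add: E.prob_space algebra_simps)
  finally show ?case .
qed

section \<open>Characteristic function of an observation\<close>

lemma real_distribution_density_lborel:
  assumes "prob_density f"
  shows "real_distribution (density lborel f)"
  using prob_space_density_lborel[OF assms]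
  by (simp add: real_distribution_def real_distribution_axioms_def)

lemma real_distribution_obs_law:
  assumes "prob_density f" "prob_density k"
  shows "real_distribution (obs_law k p f)"
  using prob_space_obs_law[OF assms]
  by (simp add: real_distribution_def real_distribution_axioms_def obs_law_def)

lemma char_density_lborel:
  assumes "prob_density f"
  shows "char (density lborel f) t = fourier (\<lambda>x. complex_of_real (f x)) t"
proof -
  have [measurable]: "f \<in> borel_measurable borel" and "\<And>x. 0 \<le> f x"
    using assms by (auto simp: prob_density_def)
  then show ?thesis
    unfolding char_def fourier_def
    by (subst integral_density) (auto simp: scaleR_conv_of_real mult.commute)
qed

text \<open>Fubini separates the Bernoulli variable from the pair of densities. Conditionally on it,
  the characteristic function factorises, and averaging over its two values gives the
  mixture.\<close>

lemma char_obs_law: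
  assumes f: "prob_density f" and k: "prob_density k" and p: "0 \<le> p" "p < 1"
  shows "char (obs_law k p f) t =
    (of_real p + of_real (1 - p) * char (density lborel f) t) * char (density lborel k) t"
proof -
  interpret F: real_distribution "density lborel f" by (rule real_distribution_density_lborel) fact
  interpret K: real_distribution "density lborel k" by (rule real_distribution_density_lborel) fact
  interpret FK: pair_prob_space "density lborel f" "density lborel k" ..
  let ?B = "measure_pmf (bernoulli_pmf (1 - p))"
  interpret B: pair_prob_space ?B "density lborel f \<Otimes>\<^sub>M density lborel k" ..
  \<comment> \<open>Both values of \<open>a\<close> are handled at once: for
    \<open>a = False\<close> the first factor is the characteristic function at 0, which is 1 and
    later produces the summand \<open>p\<close>.\<close>
  have inner: "(LINT vz|(density lborel f \<Otimes>\<^sub>M density lborel k).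
      iexp (t * (of_bool a * fst vz + snd vz))) =
      char (density lborel f) (t * of_bool a) * char (density lborel k) t" for a
  proof -
    have "(LINT vz|(density lborel f \<Otimes>\<^sub>M density lborel k).
        iexp (t * (of_bool a * fst vz + snd vz))) =
      (LINT v|density lborel f. LINT z|density lborel k. iexp (t * (of_bool a * v + z)))"
      by (subst FK.integral_fst'[symmetric])
         (auto intro!: FK.integrable_const_bound[of _ 1])
    also have "\<dots> = (LINT v|density lborel f. iexp (t * of_bool a * v) * char (density lborel k) t)"
      unfolding char_def by (simp add: exp_add algebra_simps)
    finally show ?thesis unfolding char_def by simp
  qed
  have "char (obs_law k p f) t =
    (LINT avz|(?B \<Otimes>\<^sub>M (density lborel f \<Otimes>\<^sub>M density lborel k)).
      iexp (t * (of_bool (fst avz) * fst (snd avz) + snd (snd avz))))"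
    unfolding char_def obs_law_def
    by (subst integral_distr) (auto simp: case_prod_beta)
  also have "\<dots> = (LINT a|?B. LINT vz|(density lborel f \<Otimes>\<^sub>M density lborel k).
      iexp (t * (of_bool a * fst vz + snd vz)))"
    by (subst B.integral_fst'[symmetric]) (auto intro!: B.integrable_const_bound[of _ 1])
  also have "\<dots> = (of_real p + of_real (1 - p) * char (density lborel f) t) * char (density lborel k) t"
    unfolding inner using p F.char_zero
    by (subst integral_measure_pmf[of UNIV]) (auto simp: UNIV_bool scaleR_conv_of_real algebra_simps)
  finally show ?thesis .
qed

text \<open>The mixture factor is a convex combination of two points of the closed unit disc. The
  resulting majorant depends on neither \<open>p\<close> nor \<open>f\<close>, which is what makes
  the variance bound uniform.\<close>

lemma cmod_char_obs_law_le:
  assumes f: "prob_density f" and k: "prob_density k" and p: "0 \<le> p" "p < 1"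
  shows "cmod (char (obs_law k p f) t) \<le> cmod (char (density lborel k) t)"
proof -
  interpret F: real_distribution "density lborel f" by (rule real_distribution_density_lborel) fact
  have "cmod (of_real p + of_real (1 - p) * char (density lborel f) t) \<le>
      p + (1 - p) * cmod (char (density lborel f) t)"
    using p by (intro order_trans[OF norm_triangle_ineq]) (simp add: norm_mult del: of_real_diff)
  also have "\<dots> \<le> p + (1 - p) * 1"
    using p F.cmod_char_le_1 by (intro add_left_mono mult_left_mono) auto
  finally show ?thesis
    unfolding char_obs_law[OF assms] norm_mult by (intro mult_left_le_one_le) auto
qed

section \<open>Mean and second moment of a Fourier integral evaluated at a random point\<close>

text \<open>Tonelli with invariance of Lebesgue measure under reflection and translation. The two
  identities treat the two halves of the Schur test, where the weight sits on the first or on the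
  second variable.\<close>

lemma nn_integral_convolution_lborel:
  fixes a b :: "real \<Rightarrow> ennreal"
  assumes [measurable]: "a \<in> borel_measurable borel" "b \<in> borel_measurable borel"
  shows "(\<integral>\<^sup>+t. \<integral>\<^sup>+s. a t * b (t - s) \<partial>lborel \<partial>lborel) =
      (\<integral>\<^sup>+t. a t \<partial>lborel) * (\<integral>\<^sup>+t. b t \<partial>lborel)"
    and "(\<integral>\<^sup>+t. \<integral>\<^sup>+s. a s * b (t - s) \<partial>lborel \<partial>lborel) =
      (\<integral>\<^sup>+t. a t \<partial>lborel) * (\<integral>\<^sup>+t. b t \<partial>lborel)"
proof -
  have "(\<integral>\<^sup>+s. b (t - s) \<partial>lborel) = (\<integral>\<^sup>+s. b s \<partial>lborel)" for t
    using nn_integral_real_affine[of b "-1" t] by simp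
  then show "(\<integral>\<^sup>+t. \<integral>\<^sup>+s. a t * b (t - s) \<partial>lborel \<partial>lborel) =
      (\<integral>\<^sup>+t. a t \<partial>lborel) * (\<integral>\<^sup>+t. b t \<partial>lborel)"
    by (simp add: nn_integral_cmult nn_integral_multc)
  have "(\<integral>\<^sup>+t. b (t - s) \<partial>lborel) = (\<integral>\<^sup>+t. b t \<partial>lborel)" for s
    using nn_integral_real_affine[of b 1 "-s"] by simp
  then show "(\<integral>\<^sup>+t. \<integral>\<^sup>+s. a s * b (t - s) \<partial>lborel \<partial>lborel) =
      (\<integral>\<^sup>+t. a t \<partial>lborel) * (\<integral>\<^sup>+t. b t \<partial>lborel)"
    by (subst lborel_pair.Fubini') (simp_all add: nn_integral_cmult nn_integral_multc)
qed

text \<open>Fubini applies because the exponential has modulus 1 and \<open>M\<close> has mass 1, so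
  \<open>h\<close> alone dominates. This computes the mean of the estimator.\<close>

lemma (in real_distribution) integral_fourier_eq:
  fixes h :: "real \<Rightarrow> complex"
  assumes h: "integrable lborel h"
  shows "(LINT y|M. LINT t|lborel. h t * iexp (t * y)) = (LINT t|lborel. h t * char M t)"
proof -
  interpret P: pair_sigma_finite lborel M ..
  have [measurable]: "h \<in> borel_measurable borel" using h by auto
  have "integrable (lborel \<Otimes>\<^sub>M M) (\<lambda>(t, y). h t * iexp (t * y))"
  proof (rule P.Fubini_integrable)
    show "integrable lborel (\<lambda>t. LINT y|M. norm (case (t, y) of (t, y) \<Rightarrow> h t * iexp (t * y)))"
      using h by (simp add: norm_mult prob_space)
    show "AE t in lborel. integrable M (\<lambda>y. case (t, y) of (t, y) \<Rightarrow> h t * iexp (t * y))"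
      by (auto intro!: integrable_const_bound[of _ "cmod (h _)"] simp: norm_mult)
  qed measurable
  then have "(LINT y|M. LINT t|lborel. h t * iexp (t * y)) =
      (LINT t|lborel. LINT y|M. h t * iexp (t * y))"
    by (rule P.Fubini_integral)
  then show ?thesis by (simp add: char_def)
qed

text \<open>Writing the square as a double integral and integrating over \<open>y\<close> first
  leaves \<open>char M\<close> at the difference of the frequencies, to which the Schur test
  applies. The majorant \<open>b\<close> replaces \<open>char M\<close> so that the bound can be the
  same for all laws dominated by one \<open>b\<close>.\<close>

lemma (in real_distribution) second_moment_fourier_le:
  fixes h :: "real \<Rightarrow> complex" and b :: "real \<Rightarrow> real"
  assumes h: "integrable lborel h" and h2: "integrable lborel (\<lambda>t. (cmod (h t))\<^sup>2)"
    and b: "integrable lborel b" "\<And>t. cmod (char M t) \<le> b t"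
  shows "(LINT y|M. (cmod (LINT t|lborel. h t * iexp (t * y)))\<^sup>2) \<le>
    (LINT t|lborel. (cmod (h t))\<^sup>2) * (LINT t|lborel. b t)"
proof -
  interpret Q: pair_sigma_finite "lborel \<Otimes>\<^sub>M lborel :: (real \<times> real) measure" M ..
  let ?P = "lborel \<Otimes>\<^sub>M lborel :: (real \<times> real) measure"
  have [measurable]: "h \<in> borel_measurable borel" "b \<in> borel_measurable borel"
    using h b by auto
  have b0: "0 \<le> b t" for t using b(2)[of t] norm_ge_zero order_trans by blast
  define H where "H = (\<lambda>x::real \<times> real. h (fst x) * cnj (h (snd x)))"
  have [measurable]: "cnj \<in> borel_measurable borel"
    by (intro borel_measurable_continuous_onI continuous_intros)
  have [measurable]: "H \<in> borel_measurable ?P" unfolding H_def by measurable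
  have H: "integrable ?P H"
    unfolding H_def
  proof (rule lborel_pair.Fubini_integrable)
    show "integrable lborel (\<lambda>t. LINT s|lborel. norm (h (fst (t, s)) * cnj (h (snd (t, s)))))"
      using h by (simp add: norm_mult)
    show "AE t in lborel. integrable lborel (\<lambda>s. h (fst (t, s)) * cnj (h (snd (t, s))))"
      using h by simp
  qed measurable
  have G: "integrable (?P \<Otimes>\<^sub>M M) (\<lambda>(x, y). H x * iexp ((fst x - snd x) * y))"
  proof (rule Q.Fubini_integrable)
    show "integrable ?P (\<lambda>x. LINT y|M. norm (case (x, y) of (x, y) \<Rightarrow> H x * iexp ((fst x - snd x) * y)))"
      using H by (simp add: norm_mult prob_space)
    show "AE x in ?P. integrable M (\<lambda>y. case (x, y) of (x, y) \<Rightarrow> H x * iexp ((fst x - snd x) * y))"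
      by (auto intro!: integrable_const_bound[of _ "cmod (H _)"] simp: norm_mult)
  qed measurable
  \<comment> \<open>A squared modulus is a number times its conjugate; conjugating the second
    integral turns the two phases into a phase in the difference of the frequencies.\<close>
  have sq: "of_real ((cmod (LINT t|lborel. h t * iexp (t * y)))\<^sup>2) =
      (LINT x|?P. H x * iexp ((fst x - snd x) * y))" for y
  proof -
    have eq: "H (t, s) * iexp ((t - s) * y) = (h t * iexp (t * y)) * cnj (h s * iexp (s * y))" for t s
      unfolding H_def by (simp add: exp_cnj algebra_simps flip: exp_add)
    have intP: "integrable ?P (\<lambda>x. H x * iexp ((fst x - snd x) * y))"
      using H by (rule Bochner_Integration.integrable_bound) (auto simp: norm_mult)
    have "(LINT x|?P. H x * iexp ((fst x - snd x) * y)) =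
      (LINT t|lborel. LINT s|lborel. (h t * iexp (t * y)) * cnj (h s * iexp (s * y)))"
      by (subst lborel_pair.integral_fst'[OF intP, symmetric]) (simp only: fst_conv snd_conv eq)
    also have "\<dots> = (LINT t|lborel. h t * iexp (t * y)) * cnj (LINT t|lborel. h t * iexp (t * y))"
      by (simp only: integral_mult_right_zero integral_mult_left_zero Bochner_Integration.integral_cnj)
    finally show ?thesis by (simp only: complex_norm_square)
  qed
  have "of_real (LINT y|M. (cmod (LINT t|lborel. h t * iexp (t * y)))\<^sup>2) =
      (LINT y|M. LINT x|?P. H x * iexp ((fst x - snd x) * y))"
    by (subst integral_complex_of_real[symmetric]) (simp only: sq)
  also have "\<dots> = (LINT x|?P. LINT y|M. H x * iexp ((fst x - snd x) * y))"
    using G by (rule Q.Fubini_integral)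
  also have "\<dots> = (LINT x|?P. H x * char M (fst x - snd x))"
    by (simp add: char_def)
  finally have eq: "of_real (LINT y|M. (cmod (LINT t|lborel. h t * iexp (t * y)))\<^sup>2) =
      (LINT x|?P. H x * char M (fst x - snd x))" .
  \<comment> \<open>The left side is a nonnegative real, so nothing is lost in passing to the
    modulus of the double integral.\<close>
  have "ennreal (LINT y|M. (cmod (LINT t|lborel. h t * iexp (t * y)))\<^sup>2) =
      ennreal (cmod (LINT x|?P. H x * char M (fst x - snd x)))"
    unfolding eq[symmetric] by (simp only: norm_of_real) simp
  also have "\<dots> \<le> (\<integral>\<^sup>+x. ennreal (cmod (H x * char M (fst x - snd x))) \<partial>?P)"
    by (rule integral_norm_bound_ennreal)
       (rule Bochner_Integration.integrable_bound[OF H],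
        auto simp: norm_mult intro!: mult_right_le_one_le cmod_char_le_1)
  also have "\<dots> \<le> (\<integral>\<^sup>+x. ennreal ((cmod (h (fst x)))\<^sup>2 / 2) * ennreal (b (fst x - snd x)) +
      ennreal ((cmod (h (snd x)))\<^sup>2 / 2) * ennreal (b (fst x - snd x)) \<partial>?P)"
  proof (rule nn_integral_mono)
    fix x :: "real \<times> real"
    \<comment> \<open>The product of the moduli of \<open>h\<close> is at most half the sum of their
      squares. In each resulting term one variable occurs only in \<open>b\<close> and can be
      integrated out.\<close>
    have "cmod (H x * char M (fst x - snd x)) \<le>
      ((cmod (h (fst x)))\<^sup>2 / 2 + (cmod (h (snd x)))\<^sup>2 / 2) * b (fst x - snd x)"
      unfolding norm_mult H_def using sum_squares_bound[of "cmod (h (fst x))" "cmod (h (snd x))"]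
      by (intro mult_mono b(2)) auto
    then show "ennreal (cmod (H x * char M (fst x - snd x))) \<le>
      ennreal ((cmod (h (fst x)))\<^sup>2 / 2) * ennreal (b (fst x - snd x)) +
      ennreal ((cmod (h (snd x)))\<^sup>2 / 2) * ennreal (b (fst x - snd x))"
      using b0 by (simp add: ennreal_mult[symmetric] ennreal_plus[symmetric] distrib_right ennreal_leI
          del: ennreal_plus)
  qed
  also have "\<dots> = (\<integral>\<^sup>+t. ennreal ((cmod (h t))\<^sup>2 / 2) \<partial>lborel) * (\<integral>\<^sup>+t. ennreal (b t) \<partial>lborel) +
      (\<integral>\<^sup>+t. ennreal ((cmod (h t))\<^sup>2 / 2) \<partial>lborel) * (\<integral>\<^sup>+t. ennreal (b t) \<partial>lborel)"
    by (subst nn_integral_add, simp, simp)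
       (simp add: lborel.nn_integral_fst[symmetric] nn_integral_convolution_lborel
         [of "\<lambda>t. ennreal ((cmod (h t))\<^sup>2 / 2)" "\<lambda>t. ennreal (b t)"])
  also have "\<dots> = ennreal ((LINT t|lborel. (cmod (h t))\<^sup>2) * (LINT t|lborel. b t))"
    using h2 b(1) b0
    by (simp add: nn_integral_eq_integral ennreal_mult[symmetric] ennreal_plus[symmetric]
        del: ennreal_plus)
  finally show ?thesis
    using b0 by (subst (asm) ennreal_le_iff) auto
qed

section \<open>Measurability of the transform and growth of the reciprocal characteristic
  function\<close>

text \<open>In the absolutely convergent case the transform is a parameter integral of a jointly
  measurable function; in the Plancherel case measurability is part of the definition.\<close>

lemma borel_measurable_is_fourier_transform:
  assumes "is_fourier_transform u \<phi>"
  shows "\<phi> \<in> borel_measurable borel"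
  using assms unfolding is_fourier_transform_def
proof
  assume u: "integrable lborel u \<and> (\<forall>t. \<phi> t = fourier u t)"
  then have [measurable]: "u \<in> borel_measurable borel" by auto
  have "\<phi> = (\<lambda>t. LINT x|lborel. iexp (t * x) * u x)"
    using u by (auto simp: fourier_def)
  then show ?thesis by simp
qed auto

text \<open>Turns a bound near infinity into one on the whole line: on a compact interval the
  reciprocal is continuous, since the characteristic function has no zeros, hence bounded, and
  \<open>b \<ge> 1\<close> absorbs that bound into the constant.\<close>

lemma (in real_distribution) inverse_cmod_char_le:
  fixes b :: "real \<Rightarrow> real"
  assumes nz: "\<And>t. char M t \<noteq> 0" and b: "\<And>t. 1 \<le> b t"
    and ev: "\<forall>\<^sub>F t in at_infinity. inverse (cmod (char M t)) \<le> D * b t"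
  shows "\<exists>C>0. \<forall>t. inverse (cmod (char M t)) \<le> C * b t"
proof -
  obtain R where R: "\<And>t. R \<le> norm t \<Longrightarrow> inverse (cmod (char M t)) \<le> D * b t"
    using ev by (auto simp: eventually_at_infinity)
  have "continuous_on {-R..R} (\<lambda>t. inverse (cmod (char M t)))"
    using nz isCont_char by (auto intro!: continuous_at_imp_continuous_on continuous_intros)
  then have "bounded ((\<lambda>t. inverse (cmod (char M t))) ` {-R..R})"
    by (intro compact_imp_bounded compact_continuous_image) auto
  then obtain C1 where C1: "\<forall>t\<in>{-R..R}. inverse (cmod (char M t)) \<le> C1"
    by (auto simp: bounded_iff)
  define C where "C = max 1 (max C1 D)"
  have C: "1 \<le> C" "C1 \<le> C" "D \<le> C" by (auto simp: C_def)
  have "inverse (cmod (char M t)) \<le> C * b t" for t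
  proof (cases "R \<le> norm t")
    case True
    from R[OF this] have "inverse (cmod (char M t)) \<le> D * b t" .
    also have "\<dots> \<le> C * b t" using C b[of t] by (intro mult_right_mono) auto
    finally show ?thesis .
  next
    case False
    then have "inverse (cmod (char M t)) \<le> C1" by (intro C1[rule_format]) auto
    also have "\<dots> \<le> C * b t" using C b[of t] mult_left_mono[of 1 "b t" C] by linarith
    finally show ?thesis .
  qed
  with C show ?thesis by (intro exI[of _ C]) auto
qed

text \<open>The comparison of powers of a logarithm with the identity, read at
  \<open>exp s\<close>.\<close>

lemma powr_le_exp:
  fixes s a :: real
  assumes "s > 0" "a > 0"
  shows "s powr a \<le> a powr a * exp s"
  using ln_powr_bound2[of "exp s" a] assms by simp

text \<open>The shift to \<open>1 + \<bar>t\<bar>\<close> keeps the majorant at least 1 near the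
  origin and changes nothing essential at infinity.\<close>

lemma (in real_distribution) inverse_cmod_char_le_polynomial:
  assumes nz: "\<And>t. char M t \<noteq> 0" and "d\<^sub>0 > 0" "\<beta> > 0"
    and ev: "\<forall>\<^sub>F t in at_infinity. d\<^sub>0 * \<bar>t\<bar> powr (-\<beta>) \<le> cmod (char M t)"
  shows "\<exists>C>0. \<forall>t. inverse (cmod (char M t)) \<le> C * (1 + \<bar>t\<bar>) powr \<beta>"
proof (rule inverse_cmod_char_le[OF nz])
  show "1 \<le> (1 + \<bar>t\<bar>) powr \<beta>" for t
    using \<open>\<beta> > 0\<close> by (intro ge_one_powr_ge_zero) auto
  have "\<forall>\<^sub>F t::real in at_infinity. 1 \<le> norm t" by (auto simp: eventually_at_infinity)
  with ev show "\<forall>\<^sub>F t in at_infinity. inverse (cmod (char M t)) \<le> inverse d\<^sub>0 * (1 + \<bar>t\<bar>) powr \<beta>"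
  proof eventually_elim
    case (elim t)
    then have "inverse (cmod (char M t)) \<le> inverse (d\<^sub>0 * \<bar>t\<bar> powr (-\<beta>))"
      using \<open>d\<^sub>0 > 0\<close> by (intro le_imp_inverse_le) auto
    also have "\<dots> = inverse d\<^sub>0 * \<bar>t\<bar> powr \<beta>"
      by (simp add: powr_minus)
    also have "\<dots> \<le> inverse d\<^sub>0 * (1 + \<bar>t\<bar>) powr \<beta>"
      using \<open>d\<^sub>0 > 0\<close> \<open>\<beta> > 0\<close> by (intro mult_left_mono powr_mono2) auto
    finally show ?case .
  qed
qed

text \<open>The power factor, whose exponent may have either sign, is absorbed into the exponential
  by enlarging its rate from \<open>1 / \<gamma>\<close> to \<open>3 / (2 * \<gamma>)\<close>. Any
  rate strictly below \<open>2 / \<gamma>\<close> leaves a negative power of \<open>n\<close> in the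
  variance at the bandwidth chosen later.\<close>

lemma (in real_distribution) inverse_cmod_char_le_exponential:
  assumes nz: "\<And>t. char M t \<noteq> 0" and "d\<^sub>0 > 0" "\<beta> > 0" "\<gamma> > 0"
    and ev: "\<forall>\<^sub>F t in at_infinity.
      d\<^sub>0 * \<bar>t\<bar> powr \<beta>\<^sub>0 * exp (-(\<bar>t\<bar> powr \<beta>) / \<gamma>) \<le> cmod (char M t)"
  shows "\<exists>C>0. \<forall>t. inverse (cmod (char M t)) \<le> C * exp (3 / (2 * \<gamma>) * \<bar>t\<bar> powr \<beta>)"
proof (rule inverse_cmod_char_le[OF nz])
  show "1 \<le> exp (3 / (2 * \<gamma>) * \<bar>t\<bar> powr \<beta>)" for t
    using \<open>\<gamma> > 0\<close> by simp
  \<comment> \<open>Chosen so that \<open>\<beta> * a\<close> exceeds the modulus of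
    \<open>\<beta>\<^sub>0\<close>; the added 1 keeps \<open>a\<close> positive.\<close>
  define a where "a = (\<bar>\<beta>\<^sub>0\<bar> + 1) / \<beta>"
  have "a > 0" unfolding a_def using \<open>\<beta> > 0\<close> by simp
  define D where "D = inverse d\<^sub>0 * ((2 * \<gamma>) powr a * a powr a)"
  have "\<forall>\<^sub>F t::real in at_infinity. 1 \<le> norm t" by (auto simp: eventually_at_infinity)
  with ev show "\<forall>\<^sub>F t in at_infinity.
      inverse (cmod (char M t)) \<le> D * exp (3 / (2 * \<gamma>) * \<bar>t\<bar> powr \<beta>)"
  proof eventually_elim
    case (elim t)
    \<comment> \<open>With \<open>s\<close> half of the exponent, the reciprocal exponential is
      \<open>exp (2 * s)\<close> and the power factor costs one more \<open>exp s\<close>.\<close>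
    define s where "s = \<bar>t\<bar> powr \<beta> / (2 * \<gamma>)"
    have "s > 0" unfolding s_def using elim \<open>\<gamma> > 0\<close> by simp
    have "\<bar>t\<bar> powr (-\<beta>\<^sub>0) \<le> \<bar>t\<bar> powr (\<beta> * a)"
      unfolding a_def using elim \<open>\<beta> > 0\<close> by (intro powr_mono) auto
    also have "\<dots> = (2 * \<gamma>) powr a * s powr a"
      unfolding s_def using elim \<open>\<gamma> > 0\<close> by (simp add: powr_powr[symmetric] powr_mult[symmetric])
    also have "\<dots> \<le> (2 * \<gamma>) powr a * (a powr a * exp s)"
      using \<open>s > 0\<close> \<open>a > 0\<close> by (intro mult_left_mono powr_le_exp) auto
    finally have t: "\<bar>t\<bar> powr (-\<beta>\<^sub>0) \<le> (2 * \<gamma>) powr a * (a powr a * exp s)" .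
    have "inverse (cmod (char M t)) \<le> inverse (d\<^sub>0 * \<bar>t\<bar> powr \<beta>\<^sub>0 * exp (-(\<bar>t\<bar> powr \<beta>) / \<gamma>))"
      using elim \<open>d\<^sub>0 > 0\<close> by (intro le_imp_inverse_le) auto
    also have "\<dots> = inverse d\<^sub>0 * exp (2 * s) * \<bar>t\<bar> powr (-\<beta>\<^sub>0)"
      using \<open>\<gamma> > 0\<close> by (simp add: powr_minus exp_minus[symmetric] s_def mult_ac)
    also have "\<dots> \<le> inverse d\<^sub>0 * exp (2 * s) * ((2 * \<gamma>) powr a * (a powr a * exp s))"
      using \<open>d\<^sub>0 > 0\<close> by (intro mult_left_mono t) auto
    also have "\<dots> = D * exp (3 * s)"
      unfolding D_def by (simp add: exp_add[symmetric])
    also have "3 * s = 3 / (2 * \<gamma>) * \<bar>t\<bar> powr \<beta>" by (simp add: s_def)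
    finally show ?case .
  qed
qed

section \<open>Risk bound for a fixed bandwidth\<close>

lemma integrable_bounded_by_indicator:
  fixes f :: "'a \<Rightarrow> 'b::{banach, second_countable_topology}"
  assumes "A \<in> sets M" "emeasure M A < \<infinity>" "f \<in> borel_measurable M"
    and le: "\<And>x. norm (f x) \<le> c * indicator A x"
  shows "integrable M f"
proof (rule integrableI_bounded_set[of A _ _ c])
  have "norm (f x) \<le> c" if "x \<in> A" for x using le[of x] that by simp
  then show "AE x in M. x \<in> A \<longrightarrow> norm (f x) \<le> c" by auto
  have "f x = 0" if "x \<notin> A" for x using le[of x] that by simp
  then show "AE x in M. x \<notin> A \<longrightarrow> f x = 0" by auto
qed (use assms in auto)

text \<open>The first summand bounds the squared bias, the second the variance. Neither involves
  \<open>p\<close> or \<open>f\<close>, so the bound passes to the suprema, and keeping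
  \<open>g\<close> and \<open>B\<close> free lets both decay regimes use it.\<close>

lemma mse_le:
  fixes \<alpha> K U B g p :: real and \<phi> k f :: "real \<Rightarrow> real" and n :: nat
  assumes \<phi>_meas [measurable]: "\<phi> \<in> borel_measurable borel"
    and sym: "\<And>t. \<phi> (-t) = \<phi> t"
    and \<phi>_le: "\<And>t. \<bar>\<phi> t\<bar> \<le> U * \<bar>t\<bar> powr \<alpha>"
    and \<phi>_int: "(LINT t:{-1..1}|lborel. \<phi> t) = 2"
    and "\<alpha> \<ge> 0" "U \<ge> 0" "K \<ge> 0"
    and k: "prob_density k" and k_int: "integrable lborel (char (density lborel k))"
    and k_nz: "\<And>t. char (density lborel k) t \<noteq> 0"
    and f: "f \<in> Sobolev_class \<alpha> K" and p: "0 \<le> p" "p < 1"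
    and "n \<ge> 1" "g > 0"
    and B: "\<And>t. \<bar>t\<bar> \<le> 1 / g \<Longrightarrow> inverse (cmod (char (density lborel k) t)) \<le> B"
  shows "mse k \<phi> n g p f \<le> ennreal (U\<^sup>2 * K / 2 * g powr (2 * \<alpha> + 1) +
    U\<^sup>2 * (LINT t|lborel. cmod (char (density lborel k) t)) / 2 * (g * B\<^sup>2 / real n))"
proof -
  define Z where "Z = char (density lborel k)"
  define F where "F = char (density lborel f)"
  define M where "M = obs_law k p f"
  define I where "I = {-1 / g..1 / g}"
  \<comment> \<open>\<open>q\<close> is the weight that remains in the bias once \<open>Z\<close>
    cancels; \<open>h\<close> is the weight actually applied to the data, and \<open>W y\<close> is
    the estimator computed from the single observation \<open>y\<close>.\<close>
  define q where "q t = g / 2 * indicator I t * \<phi> (g * t)" for t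
  define h where "h t = of_real (q t) / Z t" for t
  define W where "W y = (LINT t|lborel. h t * iexp (t * y))" for y
  define w where "w y = Re (W y)" for y
  define m where "m = (LINT y|M. w y)"
  have pf: "prob_density f" and f_int: "(\<integral>\<^sup>+t. ennreal ((cmod (F t))\<^sup>2 * (1 + \<bar>t\<bar> powr (2 * \<alpha>)))
        \<partial>lborel) \<le> ennreal K"
    using f by (auto simp: Sobolev_class_def F_def char_density_lborel)
  interpret F: real_distribution "density lborel f" by (rule real_distribution_density_lborel) fact
  interpret Z: real_distribution "density lborel k" by (rule real_distribution_density_lborel) fact
  interpret M: real_distribution M
    unfolding M_def by (rule real_distribution_obs_law) fact+
  have Z_meas [measurable]: "Z \<in> borel_measurable borel" unfolding Z_def by (rule Z.char_measurable)
  have F_meas [measurable]: "F \<in> borel_measurable borel" unfolding F_def by (rule F.char_measurable)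
  have [measurable]: "I \<in> sets borel" unfolding I_def by simp
  have I: "t \<in> I \<longleftrightarrow> \<bar>t\<bar> \<le> 1 / g" for t unfolding I_def by auto
  have em_I: "emeasure lborel I = ennreal (2 / g)" "measure lborel I = 2 / g"
    unfolding I_def using \<open>g > 0\<close> by auto
  have [measurable]: "q \<in> borel_measurable borel" unfolding q_def by measurable
  have [measurable]: "h \<in> borel_measurable borel" unfolding h_def by measurable
  \<comment> \<open>Two bounds on \<open>q\<close> are needed: this one keeps the power of
    \<open>t\<close>, to be paired with the Sobolev weight in the bias, while \<open>q_le'\<close>
    discards it through \<open>\<bar>g * t\<bar> \<le> 1\<close> for the variance.\<close>
  have q_le: "\<bar>q t\<bar> \<le> (g / 2 * U * g powr \<alpha>) * indicator I t * \<bar>t\<bar> powr \<alpha>" for t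
  proof -
    have "\<bar>q t\<bar> \<le> g / 2 * indicator I t * (U * \<bar>g * t\<bar> powr \<alpha>)"
      unfolding q_def abs_mult[of _ "\<phi> _"] using \<open>g > 0\<close> \<phi>_le[of "g * t"]
      by (intro mult_mono) auto
    then show ?thesis using \<open>g > 0\<close> by (simp add: abs_mult powr_mult mult_ac)
  qed
  have q_le': "\<bar>q t\<bar> \<le> g / 2 * U * indicator I t" for t
  proof (cases "t \<in> I")
    case True
    then have "\<bar>g * t\<bar> powr \<alpha> \<le> 1"
      using \<open>g > 0\<close> \<open>\<alpha> \<ge> 0\<close> by (intro powr_le1) (auto simp: I abs_mult field_simps)
    then have "\<bar>\<phi> (g * t)\<bar> \<le> U"
      using \<phi>_le[of "g * t"] \<open>U \<ge> 0\<close> by (smt (verit) mult_left_le)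
    then show ?thesis unfolding q_def using \<open>g > 0\<close> True by (simp add: abs_mult)
  qed (simp add: q_def)
  have h_le: "cmod (h t) \<le> g / 2 * U * B * indicator I t" for t
  proof -
    have "cmod (h t) = \<bar>q t\<bar> * inverse (cmod (Z t))"
      by (simp add: h_def divide_inverse norm_mult norm_inverse)
    also have "\<dots> \<le> g / 2 * U * indicator I t * B"
    proof (cases "t \<in> I")
      case True
      then show ?thesis
        using q_le'[of t] B[of t] \<open>g > 0\<close> \<open>U \<ge> 0\<close> by (intro mult_mono) (auto simp: Z_def I)
    qed (simp add: q_def)
    finally show ?thesis by (simp add: mult_ac)
  qed
  have int_q: "integrable lborel q"
    using q_le' em_I by (intro integrable_bounded_by_indicator[of I _ _ "g / 2 * U"]) (simp_all only: real_norm_def, auto)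
  have int_h: "integrable lborel h"
    using h_le em_I by (intro integrable_bounded_by_indicator[of I _ _ "g / 2 * U * B"]) auto
  have h2_le: "(cmod (h t))\<^sup>2 \<le> (g / 2 * U * B)\<^sup>2 * indicator I t" for t
    using power_mono[OF h_le[of t], of 2] by (simp split: split_indicator_asm split_indicator)
  have int_h2: "integrable lborel (\<lambda>t. (cmod (h t))\<^sup>2)"
    using h2_le em_I by (intro integrable_bounded_by_indicator[of I _ _ "(g / 2 * U * B)\<^sup>2"]) auto
  have h2: "(LINT t|lborel. (cmod (h t))\<^sup>2) \<le> g * U\<^sup>2 * B\<^sup>2 / 2"
  proof -
    have "(LINT t|lborel. (cmod (h t))\<^sup>2) \<le> (LINT t|lborel. (g / 2 * U * B)\<^sup>2 * indicator I t)"
      using h2_le em_I by (intro integral_mono int_h2 integrable_mult_right integrable_real_indicator) auto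
    \<comment> \<open>The squared supremum of \<open>h\<close> is multiplied by the length
      \<open>2 / g\<close> of the frequency band, which leaves a single factor
      \<open>g\<close>.\<close>
    also have "\<dots> = g * U\<^sup>2 * B\<^sup>2 / 2"
      using em_I \<open>g > 0\<close> by (simp add: power2_eq_square field_simps)
    finally show ?thesis .
  qed
  have [measurable]: "W \<in> borel_measurable borel" unfolding W_def by measurable
  have [measurable]: "w \<in> borel_measurable borel" unfolding w_def by measurable
  have estimator: "atom_estimator k \<phi> N g x = (\<Sum>j=1..N. W (x j)) / of_nat N" for N x
  proof -
    have int_hx: "integrable lborel (\<lambda>t. h t * iexp (t * y))" for y
      using int_h by (rule Bochner_Integration.integrable_bound) (auto simp: norm_mult)
    have "atom_estimator k \<phi> N g x = (LINT t|lborel. of_real (g / 2) *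
        (indicator I t *\<^sub>R (emp_char N x t * of_real (\<phi> (g * t)) / Z t)))"
      unfolding atom_estimator_def set_lebesgue_integral_def I_def Z_def
      by (rule integral_mult_right_zero[symmetric])
    also have "\<dots> = (LINT t|lborel. h t * emp_char N x t)"
      by (intro Bochner_Integration.integral_cong)
         (auto simp: h_def q_def scaleR_conv_of_real split: split_indicator)
    also have "\<dots> = (LINT t|lborel. (\<Sum>j=1..N. h t * iexp (t * x j)) / of_nat N)"
      by (simp only: emp_char_def sum_distrib_left times_divide_eq_right)
    also have "\<dots> = (\<Sum>j=1..N. W (x j)) / of_nat N"
      unfolding W_def using int_hx by (simp only: integral_divide_zero Bochner_Integration.integral_sum)
    finally show ?thesis .
  qed
  \<comment> \<open>Sample size one in \<open>estimator\<close> transfers the reality of the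
    estimator, a consequence of the symmetry of \<open>\<phi>\<close>, to each summand.\<close>
  have W_real: "W y = of_real (w y)" for y
  proof -
    have "W y = atom_estimator k \<phi> 1 g (\<lambda>_. y)" by (simp add: estimator)
    then have "W y \<in> \<real>" using atom_estimator_real[of \<phi>] sym by simp
    then show ?thesis unfolding w_def by simp
  qed
  define Bw where "Bw = (LINT t|lborel. cmod (h t))"
  have w_le: "\<bar>w y\<bar> \<le> Bw" for y
  proof -
    have "\<bar>w y\<bar> = cmod (W y)" by (simp add: W_real)
    also have "\<dots> \<le> (LINT t|lborel. cmod (h t * iexp (t * y)))"
      unfolding W_def by (rule integral_norm_bound)
    finally show ?thesis by (simp add: norm_mult Bw_def)
  qed
  have int_w: "integrable M w" "integrable M (\<lambda>y. (w y)\<^sup>2)"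
  proof -
    show "integrable M w" using w_le by (intro M.integrable_const_bound[of _ Bw]) auto
    have "(w y)\<^sup>2 \<le> Bw\<^sup>2" for y using w_le[of y] by (simp add: abs_le_square_iff[symmetric])
    then show "integrable M (\<lambda>y. (w y)\<^sup>2)" by (intro M.integrable_const_bound[of _ "Bw\<^sup>2"]) auto
  qed
  have char_M: "char M t = (of_real p + of_real (1 - p) * F t) * Z t" for t
    unfolding M_def F_def Z_def by (rule char_obs_law) fact+

  have second_moment: "(LINT y|M. (w y)\<^sup>2) \<le> g * U\<^sup>2 * B\<^sup>2 / 2 * (LINT t|lborel. cmod (Z t))"
  proof -
    have "(LINT y|M. (w y)\<^sup>2) = (LINT y|M. (cmod (W y))\<^sup>2)" by (simp add: W_real)
    also have "\<dots> \<le> (LINT t|lborel. (cmod (h t))\<^sup>2) * (LINT t|lborel. cmod (Z t))"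
      unfolding W_def using k_int cmod_char_obs_law_le[OF pf k p]
      by (intro M.second_moment_fourier_le int_h int_h2) (auto simp: Z_def M_def)
    also have "\<dots> \<le> g * U\<^sup>2 * B\<^sup>2 / 2 * (LINT t|lborel. cmod (Z t))"
      by (intro mult_right_mono h2) simp
    finally show ?thesis .
  qed

  \<comment> \<open>The normalisation of \<open>\<phi>\<close> and the prefactor
    \<open>g / 2\<close> combine, after rescaling by \<open>g\<close>, to total weight 1; the atom
    at zero thus contributes exactly \<open>p\<close> to the mean.\<close>
  have q_1: "(LINT t|lborel. q t) = 1"
  proof -
    have ind: "indicator {-1..1} (g * t) = (indicator I t :: real)" for t
      using \<open>g > 0\<close> by (auto simp: I_def indicator_def field_simps)
    have "2 = (LINT t|lborel. indicator {-1..1} t * \<phi> t)"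
      using \<phi>_int by (simp add: set_lebesgue_integral_def)
    also have "\<dots> = g * (LINT t|lborel. indicator I t * \<phi> (g * t))"
      using lborel_integral_real_affine[of g "\<lambda>t. indicator {-1..1} t * \<phi> t" 0] \<open>g > 0\<close>
      by (simp add: ind)
    finally show ?thesis unfolding q_def by (simp add: mult.assoc)
  qed
  have int_qF: "integrable lborel (\<lambda>t. of_real (q t) * F t)"
    using F.cmod_char_le_1
    by (intro Bochner_Integration.integrable_bound[OF int_q])
       (auto simp: norm_mult F_def intro!: mult_right_le_one_le)
  \<comment> \<open>The factor \<open>Z t\<close> of \<open>char M\<close> cancels the denominator
    of \<open>h\<close>; what is left beyond \<open>p\<close> is the low-frequency part of
    \<open>F\<close>.\<close>
  have mean: "of_real (m - p) = of_real (1 - p) * (LINT t|lborel. of_real (q t) * F t)"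
  proof -
    have "of_real m = (LINT y|M. W y)"
      unfolding m_def W_real by (rule integral_complex_of_real[symmetric])
    also have "\<dots> = (LINT t|lborel. h t * char M t)"
      unfolding W_def by (rule M.integral_fourier_eq[OF int_h])
    also have "\<dots> = (LINT t|lborel. of_real (q t) * of_real p + of_real (1 - p) * (of_real (q t) * F t))"
      unfolding char_M h_def using k_nz
      by (intro Bochner_Integration.integral_cong) (auto simp: Z_def algebra_simps)
    also have "\<dots> = of_real p + of_real (1 - p) * (LINT t|lborel. of_real (q t) * F t)"
      using int_q int_qF q_1 by (subst Bochner_Integration.integral_add) auto
    finally show ?thesis by simp
  qed
  have bias: "(m - p)\<^sup>2 \<le> U\<^sup>2 * K / 2 * g powr (2 * \<alpha> + 1)"
  proof -
    define c where "c = g / 2 * U * g powr \<alpha>"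
    have c0: "0 \<le> c" unfolding c_def using \<open>g > 0\<close> \<open>U \<ge> 0\<close> by simp
    have "\<bar>m - p\<bar> = cmod (of_real (m - p))" by (simp only: norm_of_real)
    also have "\<dots> \<le> cmod (LINT t|lborel. of_real (q t) * F t)"
      \<comment> \<open>Dropping the factor \<open>1 - p\<close>, which is at most 1, makes the bias
        bound uniform in \<open>p\<close>.\<close>
      unfolding mean norm_mult using p by (intro mult_left_le_one_le) (auto simp del: of_real_diff)
    finally have "ennreal \<bar>m - p\<bar> \<le> ennreal (cmod (LINT t|lborel. of_real (q t) * F t))"
      by (rule ennreal_leI)
    also have "\<dots> \<le> (\<integral>\<^sup>+t. ennreal (cmod (of_real (q t) * F t)) \<partial>lborel)"
      by (rule integral_norm_bound_ennreal[OF int_qF])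
    also have "\<dots> \<le> (\<integral>\<^sup>+t. ennreal (c * indicator I t) * ennreal (\<bar>t\<bar> powr \<alpha> * cmod (F t)) \<partial>lborel)"
    proof (rule nn_integral_mono)
      fix t
      have "cmod (of_real (q t) * F t) \<le> c * indicator I t * (\<bar>t\<bar> powr \<alpha> * cmod (F t))"
        unfolding norm_mult norm_of_real using mult_right_mono[OF q_le[of t], of "cmod (F t)"]
        by (simp add: c_def mult.assoc)
      then show "ennreal (cmod (of_real (q t) * F t)) \<le>
          ennreal (c * indicator I t) * ennreal (\<bar>t\<bar> powr \<alpha> * cmod (F t))"
        using c0 by (subst ennreal_mult[symmetric]) (auto intro: ennreal_leI)
    qed
    finally have "(ennreal \<bar>m - p\<bar>)\<^sup>2 \<le>
      (\<integral>\<^sup>+t. ennreal (c * indicator I t) * ennreal (\<bar>t\<bar> powr \<alpha> * cmod (F t)) \<partial>lborel)\<^sup>2"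
      by (rule power_mono) simp
    \<comment> \<open>Cauchy-Schwarz puts the power of \<open>t\<close> with \<open>F\<close>, where
      the Sobolev bound controls it; the other factor is a constant on a band of length
      \<open>2 / g\<close>.\<close>
    also have "\<dots> \<le> (\<integral>\<^sup>+t. (ennreal (c * indicator I t))\<^sup>2 \<partial>lborel) *
        (\<integral>\<^sup>+t. (ennreal (\<bar>t\<bar> powr \<alpha> * cmod (F t)))\<^sup>2 \<partial>lborel)"
      by (rule Cauchy_Schwarz_nn_integral) measurable
    also have "\<dots> \<le> ennreal (c\<^sup>2 * (2 / g)) * ennreal K"
    proof (rule mult_mono)
      have "(\<integral>\<^sup>+t. (ennreal (c * indicator I t))\<^sup>2 \<partial>lborel) = (\<integral>\<^sup>+t. ennreal (c\<^sup>2) * indicator I t \<partial>lborel)"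
        using c0 by (intro nn_integral_cong) (auto simp: ennreal_power split: split_indicator)
      also have "\<dots> = ennreal (c\<^sup>2 * (2 / g))"
        using \<open>g > 0\<close> by (simp add: nn_integral_cmult_indicator em_I ennreal_mult[symmetric])
      finally show "(\<integral>\<^sup>+t. (ennreal (c * indicator I t))\<^sup>2 \<partial>lborel) \<le> ennreal (c\<^sup>2 * (2 / g))"
        by simp
      have "(\<integral>\<^sup>+t. (ennreal (\<bar>t\<bar> powr \<alpha> * cmod (F t)))\<^sup>2 \<partial>lborel) \<le>
          (\<integral>\<^sup>+t. ennreal ((cmod (F t))\<^sup>2 * (1 + \<bar>t\<bar> powr (2 * \<alpha>))) \<partial>lborel)"
      proof (rule nn_integral_mono)
        fix t :: real
        have "(\<bar>t\<bar> powr \<alpha>)\<^sup>2 = \<bar>t\<bar> powr (2 * \<alpha>)"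
          by (simp add: power2_eq_square powr_add[symmetric])
        then have "(\<bar>t\<bar> powr \<alpha> * cmod (F t))\<^sup>2 \<le> (cmod (F t))\<^sup>2 * (1 + \<bar>t\<bar> powr (2 * \<alpha>))"
          by (simp add: power_mult_distrib algebra_simps)
        then show "(ennreal (\<bar>t\<bar> powr \<alpha> * cmod (F t)))\<^sup>2 \<le> ennreal ((cmod (F t))\<^sup>2 * (1 + \<bar>t\<bar> powr (2 * \<alpha>)))"
          by (subst ennreal_power) (auto intro: ennreal_leI)
      qed
      then show "(\<integral>\<^sup>+t. (ennreal (\<bar>t\<bar> powr \<alpha> * cmod (F t)))\<^sup>2 \<partial>lborel) \<le> ennreal K"
        using f_int by (rule order_trans)
    qed auto
    also have "\<dots> = ennreal (c\<^sup>2 * (2 / g) * K)"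
      using \<open>g > 0\<close> \<open>K \<ge> 0\<close> by (subst ennreal_mult[symmetric]) auto
    finally have "(m - p)\<^sup>2 \<le> c\<^sup>2 * (2 / g) * K"
      using \<open>g > 0\<close> \<open>K \<ge> 0\<close> by (simp add: ennreal_power)
    also have "\<dots> = U\<^sup>2 * K / 2 * (g powr (2 * \<alpha>) * g)"
    proof -
      have "(g powr \<alpha>)\<^sup>2 = g powr (2 * \<alpha>)" by (simp add: power2_eq_square powr_add[symmetric])
      then show ?thesis
        unfolding c_def power_mult_distrib using \<open>g > 0\<close> by (simp add: power2_eq_square field_simps)
    qed
    finally show ?thesis using \<open>g > 0\<close> by (simp add: powr_add)
  qed

  \<comment> \<open>Centring and dividing by \<open>n\<close> puts the estimation error in the form
    bias plus a sum of independent mean-zero terms.\<close>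
  define v where "v y = (w y - m) / real n" for y
  have [measurable]: "v \<in> borel_measurable M" unfolding v_def by measurable
  have v_le: "\<bar>v y\<bar> \<le> (Bw + \<bar>m\<bar>) / real n" for y
    unfolding v_def using w_le[of y] by (simp add: divide_right_mono)
  have v_mean: "(LINT y|M. v y) = 0"
    unfolding v_def using int_w M.prob_space by (simp add: m_def)
  have v_sq: "(LINT y|M. (v y)\<^sup>2) \<le> (LINT y|M. (w y)\<^sup>2) / (real n)\<^sup>2"
  proof -
    have "(LINT y|M. (v y)\<^sup>2) = M.variance w / (real n)\<^sup>2"
      unfolding v_def m_def by (simp add: power_divide)
    also have "M.variance w \<le> (LINT y|M. (w y)\<^sup>2)"
      using M.variance_eq[OF int_w] by simp
    finally show ?thesis by (simp add: divide_right_mono)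
  qed
  have "mse k \<phi> n g p f = (\<integral>\<^sup>+x. ennreal (((m - p) + (\<Sum>j\<in>{1..n}. v (x j)))\<^sup>2) \<partial>(\<Pi>\<^sub>M j\<in>{1..n}. M))"
  proof -
    have "atom_estimator k \<phi> n g x - of_real p = of_real ((m - p) + (\<Sum>j\<in>{1..n}. v (x j)))" for x
      unfolding estimator W_real v_def using \<open>n \<ge> 1\<close>
      by (simp add: sum_divide_distrib[symmetric] sum_subtractf diff_divide_distrib)
    then show ?thesis
      unfolding mse_def sample_law_def M_def[symmetric] by (simp only: norm_of_real power2_abs)
  qed
  also have "\<dots> = ennreal (LINT x|(\<Pi>\<^sub>M j\<in>{1..n}. M). ((m - p) + (\<Sum>j\<in>{1..n}. v (x j)))\<^sup>2)"
    using v_le by (intro nn_integral_eq_integral integrable_square_sum_PiM M.prob_space_axioms) auto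
  also have "\<dots> = ennreal ((m - p)\<^sup>2 + real n * (LINT y|M. (v y)\<^sup>2))"
    using v_le v_mean by (subst integral_square_sum_PiM[OF M.prob_space_axioms]) auto
  also have "\<dots> \<le> ennreal (U\<^sup>2 * K / 2 * g powr (2 * \<alpha> + 1) +
    U\<^sup>2 * (LINT t|lborel. cmod (Z t)) / 2 * (g * B\<^sup>2 / real n))"
  proof (intro ennreal_leI add_mono bias)
    have "real n * (LINT y|M. (v y)\<^sup>2) \<le> real n *
        (g * U\<^sup>2 * B\<^sup>2 / 2 * (LINT t|lborel. cmod (Z t)) / (real n)\<^sup>2)"
      using v_sq second_moment
      by (intro mult_left_mono order_trans[OF v_sq] divide_right_mono) auto
    also have "\<dots> = U\<^sup>2 * (LINT t|lborel. cmod (Z t)) / 2 * (g * B\<^sup>2 / real n)"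
      using \<open>n \<ge> 1\<close> by (simp add: power2_eq_square field_simps)
    finally show "real n * (LINT y|M. (v y)\<^sup>2) \<le>
      U\<^sup>2 * (LINT t|lborel. cmod (Z t)) / 2 * (g * B\<^sup>2 / real n)" .
  qed
  finally show ?thesis unfolding Z_def .
qed

section \<open>Arithmetic of the bandwidths\<close>

text \<open>The bandwidth solves
  \<open>g powr (2 * \<alpha> + 1) = g powr (1 - 2 * \<beta>) / x\<close> up to constants, so
  squared bias and variance decay at the same power of \<open>x\<close>.\<close>

lemma powr_bandwidth_polynomial:
  fixes \<alpha> \<beta> d x :: real
  assumes "\<alpha> > 0" "\<beta> > 0" "d > 0" "x \<ge> 1"
  defines "g \<equiv> d * x powr (-1 / (2 * \<alpha> + 2 * \<beta>))"
  shows "g powr (2 * \<alpha> + 1) = d powr (2 * \<alpha> + 1) * x powr (-(2 * \<alpha> + 1) / (2 * \<alpha> + 2 * \<beta>))"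
    and "g powr (1 - 2 * \<beta>) / x = d powr (1 - 2 * \<beta>) * x powr (-(2 * \<alpha> + 1) / (2 * \<alpha> + 2 * \<beta>))"
proof -
  show "g powr (2 * \<alpha> + 1) = d powr (2 * \<alpha> + 1) * x powr (-(2 * \<alpha> + 1) / (2 * \<alpha> + 2 * \<beta>))"
  proof -
    have "-1 / (2 * \<alpha> + 2 * \<beta>) * (2 * \<alpha> + 1) = -(2 * \<alpha> + 1) / (2 * \<alpha> + 2 * \<beta>)"
      by (simp only: times_divide_eq_left mult_minus1)
    then show ?thesis unfolding g_def powr_mult powr_powr by (simp only:)
  qed
  have e: "-1 / (2 * \<alpha> + 2 * \<beta>) * (1 - 2 * \<beta>) - 1 = -(2 * \<alpha> + 1) / (2 * \<alpha> + 2 * \<beta>)"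
    using \<open>\<alpha> > 0\<close> \<open>\<beta> > 0\<close> by (simp add: divide_simps)
  have "g powr (1 - 2 * \<beta>) / x =
      d powr (1 - 2 * \<beta>) * x powr (-1 / (2 * \<alpha> + 2 * \<beta>) * (1 - 2 * \<beta>) - 1)"
  proof -
    have "x powr (-1 / (2 * \<alpha> + 2 * \<beta>) * (1 - 2 * \<beta>) - 1) =
        x powr (-1 / (2 * \<alpha> + 2 * \<beta>) * (1 - 2 * \<beta>)) / x"
      using \<open>x \<ge> 1\<close> by (subst powr_diff) simp
    then show ?thesis unfolding g_def powr_mult powr_powr by (simp only: times_divide_eq_right)
  qed
  then show "g powr (1 - 2 * \<beta>) / x =
      d powr (1 - 2 * \<beta>) * x powr (-(2 * \<alpha> + 1) / (2 * \<alpha> + 2 * \<beta>))"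
    unfolding e .
qed

text \<open>A power of \<open>x\<close> dominates every power of its logarithm: the library bound
  with exponent \<open>4 * a\<close>, followed by a fourth root. It makes the variance negligible or
  comparable in the exponential regime.\<close>

lemma powr_minus_quarter_le_ln_powr:
  fixes x a :: real
  assumes "x > 1" "a > 0"
  shows "x powr (-1/4) \<le> ((4 * a) powr (4 * a)) powr (1/4) * ln x powr (-a)"
proof -
  have "ln x powr (4 * a) \<le> (4 * a) powr (4 * a) * x"
    using assms by (intro ln_powr_bound2) auto
  then have "(ln x powr (4 * a)) powr (1/4) \<le> ((4 * a) powr (4 * a) * x) powr (1/4)"
    by (intro powr_mono2) auto
  then have "ln x powr a \<le> ((4 * a) powr (4 * a)) powr (1/4) * x powr (1/4)"
    by (simp add: powr_powr powr_mult)
  then show ?thesis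
    using assms by (simp add: powr_minus field_simps)
qed

section \<open>Convergence rates under polynomial and exponential lower bounds for the noise\<close>

theorem theorem1:
  fixes \<alpha> K\<^sub>\<Sigma> U L :: real
    and u :: "real \<Rightarrow> complex" and \<phi>\<^sub>u k :: "real \<Rightarrow> real"
  assumes "\<alpha> > 0" and "K\<^sub>\<Sigma> > 0" and "U > 0"
    and "is_fourier_transform u (\<lambda>t. complex_of_real (\<phi>\<^sub>u t))"
    and "\<forall>t. \<phi>\<^sub>u (-t) = \<phi>\<^sub>u t"
    and "\<exists>\<epsilon>>0. continuous_on {-\<epsilon><..<\<epsilon>} \<phi>\<^sub>u"
    and "\<forall>t. t \<notin> {-1..1} \<longrightarrow> \<phi>\<^sub>u t = 0"
    and "(LINT t:{-1..1}|lborel. \<phi>\<^sub>u t) = 2"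
    and "((\<lambda>t. \<phi>\<^sub>u t / \<bar>t\<bar> powr \<alpha>) \<longlongrightarrow> L) (at 0)"
    and "\<forall>t. \<bar>if t = 0 then L else \<phi>\<^sub>u t / \<bar>t\<bar> powr \<alpha>\<bar> \<le> U"
    and "prob_density k"
    and "\<forall>t. char (density lborel k) t \<noteq> 0"
    and "integrable lborel (char (density lborel k))"
  shows
    "(\<forall>d\<^sub>0 \<beta> d. d\<^sub>0 > 0 \<and> \<beta> > 0 \<and> d > 0 \<and>
        (\<forall>\<^sub>F t in at_infinity. d\<^sub>0 * \<bar>t\<bar> powr (-\<beta>) \<le> cmod (char (density lborel k) t)) \<longrightarrow>
        (\<exists>C>0. \<forall>n\<ge>1.
          (SUP f\<in>Sobolev_class \<alpha> K\<^sub>\<Sigma>. SUP p\<in>{0..<1}.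
             mse k \<phi>\<^sub>u n (d * real n powr (-1 / (2 * \<alpha> + 2 * \<beta>))) p f)
          \<le> ennreal (C * real n powr (-(2 * \<alpha> + 1) / (2 * \<alpha> + 2 * \<beta>))))) \<and>
     (\<forall>\<beta>\<^sub>0 d\<^sub>0 \<beta> \<gamma>. d\<^sub>0 > 0 \<and> \<beta> > 0 \<and> \<gamma> > 0 \<and>
        (\<forall>\<^sub>F t in at_infinity.
           d\<^sub>0 * \<bar>t\<bar> powr \<beta>\<^sub>0 * exp (-(\<bar>t\<bar> powr \<beta>) / \<gamma>) \<le> cmod (char (density lborel k) t)) \<longrightarrow>
        (\<exists>C>0. \<forall>n\<ge>2.
          (SUP f\<in>Sobolev_class \<alpha> K\<^sub>\<Sigma>. SUP p\<in>{0..<1}.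
             mse k \<phi>\<^sub>u n ((4 / \<gamma>) powr (1 / \<beta>) * ln (real n) powr (-1 / \<beta>)) p f)
          \<le> ennreal (C * ln (real n) powr (-(2 * \<alpha> + 1) / \<beta>))))"
proof -
  note pos = assms(1-3)
  interpret Z: real_distribution "density lborel k"
    by (rule real_distribution_density_lborel) fact
  have "(\<lambda>t. Re (complex_of_real (\<phi>\<^sub>u t))) \<in> borel_measurable borel"
    using borel_measurable_is_fourier_transform[OF assms(4)] by measurable
  then have meas: "\<phi>\<^sub>u \<in> borel_measurable borel" by simp
  have nz: "\<And>t. char (density lborel k) t \<noteq> 0" using assms(12) by simp
  \<comment> \<open>At the origin the ratio hypothesis bounds only \<open>L\<close>. Since the ratio
    converges and the power of \<open>t\<close> tends to 0, continuity forces the value 0, as the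
    pointwise bound \<open>\<phi>_le\<close> requires there.\<close>
  have \<phi>_0: "\<phi>\<^sub>u 0 = 0"
  proof -
    obtain \<epsilon> where "\<epsilon> > 0" "continuous_on {-\<epsilon><..<\<epsilon>} \<phi>\<^sub>u" using assms(6) by auto
    then have "isCont \<phi>\<^sub>u 0" by (simp add: continuous_on_eq_continuous_at)
    then have c: "(\<phi>\<^sub>u \<longlongrightarrow> \<phi>\<^sub>u 0) (at 0)" by (simp add: isCont_def)
    have "((\<lambda>t::real. \<bar>t\<bar> powr \<alpha>) \<longlongrightarrow> \<bar>0\<bar> powr \<alpha>) (at 0)"
      by (rule tendsto_powr'[OF tendsto_rabs[OF tendsto_ident_at] tendsto_const]) (use pos in auto)
    then have "((\<lambda>t. \<phi>\<^sub>u t / \<bar>t\<bar> powr \<alpha> * \<bar>t\<bar> powr \<alpha>) \<longlongrightarrow> 0) (at 0)"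
      using tendsto_mult[OF assms(9)] pos by fastforce
    then have "(\<phi>\<^sub>u \<longlongrightarrow> 0) (at 0)"
      by (rule Lim_transform_eventually) (auto simp: eventually_at_filter)
    with c show ?thesis by (rule LIM_unique)
  qed
  have \<phi>_le: "\<bar>\<phi>\<^sub>u t\<bar> \<le> U * \<bar>t\<bar> powr \<alpha>" for t
  proof (cases "t = 0")
    case False
    then have "\<bar>\<phi>\<^sub>u t\<bar> / \<bar>t\<bar> powr \<alpha> \<le> U"
      using assms(10)[rule_format, of t] by (simp add: abs_divide)
    with False show ?thesis by (simp add: field_simps)
  qed (simp add: \<phi>_0)
  define J where "J = (LINT t|lborel. cmod (char (density lborel k) t))"
  have J0: "0 \<le> J" unfolding J_def by simp
  have risk: "(SUP f\<in>Sobolev_class \<alpha> K\<^sub>\<Sigma>. SUP p\<in>{0..<1}. mse k \<phi>\<^sub>u n g p f) \<le>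
      ennreal (U\<^sup>2 * K\<^sub>\<Sigma> / 2 * g powr (2 * \<alpha> + 1) + U\<^sup>2 * J / 2 * (g * B\<^sup>2 / real n))"
    if "n \<ge> 1" "g > 0" "\<And>t. \<bar>t\<bar> \<le> 1 / g \<Longrightarrow> inverse (cmod (char (density lborel k) t)) \<le> B"
    for n g B
    unfolding J_def using that pos assms(5) by (intro SUP_least mse_le meas \<phi>_le assms nz)
      (auto intro: less_imp_le)
  show ?thesis
  proof (intro conjI allI impI; elim conjE)
    fix d\<^sub>0 \<beta> d :: real
    assume d0: "d\<^sub>0 > 0" and \<beta>: "\<beta> > 0" and d: "d > 0"
      and ev: "\<forall>\<^sub>F t in at_infinity. d\<^sub>0 * \<bar>t\<bar> powr (-\<beta>) \<le> cmod (char (density lborel k) t)"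
    obtain C where C: "C > 0"
      "\<And>t. inverse (cmod (char (density lborel k) t)) \<le> C * (1 + \<bar>t\<bar>) powr \<beta>"
      using Z.inverse_cmod_char_le_polynomial[OF nz d0 \<beta> ev] by auto
    define C' where "C' = U\<^sup>2 * K\<^sub>\<Sigma> / 2 * d powr (2 * \<alpha> + 1) +
      U\<^sup>2 * J / 2 * (C\<^sup>2 * (1 + d) powr (2 * \<beta>) * d powr (1 - 2 * \<beta>))"
    have "C' > 0" unfolding C'_def using pos d J0 by (intro add_pos_nonneg mult_pos_pos) auto
    moreover have "(SUP f\<in>Sobolev_class \<alpha> K\<^sub>\<Sigma>. SUP p\<in>{0..<1}.
        mse k \<phi>\<^sub>u n (d * real n powr (-1 / (2 * \<alpha> + 2 * \<beta>))) p f)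
      \<le> ennreal (C' * real n powr (-(2 * \<alpha> + 1) / (2 * \<alpha> + 2 * \<beta>)))" if n: "n \<ge> 1" for n :: nat
    proof -
      define g where "g = d * real n powr (-1 / (2 * \<alpha> + 2 * \<beta>))"
      \<comment> \<open>Since \<open>g \<le> d\<close> for every \<open>n \<ge> 1\<close>, on the
        band \<open>1 + \<bar>t\<bar>\<close> is at most \<open>1 + 1 / g\<close>, hence at most
        \<open>(1 + d) / g\<close>.\<close>
      define B where "B = C * ((1 + d) / g) powr \<beta>"
      have g: "g > 0" unfolding g_def using d n by simp
      have "real n powr (-1 / (2 * \<alpha> + 2 * \<beta>)) \<le> 1"
        using pos n \<beta> powr_mono[of "-1 / (2 * \<alpha> + 2 * \<beta>)" 0 "real n"] by (simp add: divide_simps)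
      then have "g \<le> d" unfolding g_def using d by simp
      have B: "inverse (cmod (char (density lborel k) t)) \<le> B" if t: "\<bar>t\<bar> \<le> 1 / g" for t
      proof -
        have "1 + \<bar>t\<bar> \<le> (1 + d) / g"
          using t g \<open>g \<le> d\<close> by (simp add: field_simps)
        then have "(1 + \<bar>t\<bar>) powr \<beta> \<le> ((1 + d) / g) powr \<beta>"
          using \<beta> by (intro powr_mono2) auto
        then show ?thesis
          unfolding B_def using C by (intro order_trans[OF C(2)] mult_left_mono) auto
      qed
      have "g * B\<^sup>2 = C\<^sup>2 * (1 + d) powr (2 * \<beta>) * g powr (1 - 2 * \<beta>)"
      proof -
        have "B\<^sup>2 = C\<^sup>2 * ((1 + d) / g) powr (2 * \<beta>)"
          unfolding B_def power_mult_distrib by (simp add: power2_eq_square powr_add[symmetric])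
        then show ?thesis using d g by (simp add: powr_divide powr_diff)
      qed
      then have "g * B\<^sup>2 / real n = C\<^sup>2 * (1 + d) powr (2 * \<beta>) * (g powr (1 - 2 * \<beta>) / real n)"
        by simp
      then have eq: "U\<^sup>2 * K\<^sub>\<Sigma> / 2 * g powr (2 * \<alpha> + 1) + U\<^sup>2 * J / 2 * (g * B\<^sup>2 / real n) =
          C' * real n powr (-(2 * \<alpha> + 1) / (2 * \<alpha> + 2 * \<beta>))"
        unfolding C'_def
        using powr_bandwidth_polynomial[of \<alpha> \<beta> d "real n", folded g_def] pos \<beta> d n
        by (simp add: distrib_right mult.assoc)
      show ?thesis
        using risk[OF n g B] unfolding eq unfolding g_def .
    qed
    ultimately show "\<exists>C>0. \<forall>n\<ge>1. (SUP f\<in>Sobolev_class \<alpha> K\<^sub>\<Sigma>. SUP p\<in>{0..<1}.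
        mse k \<phi>\<^sub>u n (d * real n powr (-1 / (2 * \<alpha> + 2 * \<beta>))) p f)
      \<le> ennreal (C * real n powr (-(2 * \<alpha> + 1) / (2 * \<alpha> + 2 * \<beta>)))"
      by blast
  next
    fix \<beta>\<^sub>0 d\<^sub>0 \<beta> \<gamma> :: real
    assume d0: "d\<^sub>0 > 0" and \<beta>: "\<beta> > 0" and \<gamma>: "\<gamma> > 0"
      and ev: "\<forall>\<^sub>F t in at_infinity.
        d\<^sub>0 * \<bar>t\<bar> powr \<beta>\<^sub>0 * exp (-(\<bar>t\<bar> powr \<beta>) / \<gamma>) \<le> cmod (char (density lborel k) t)"
    obtain C where C: "C > 0"
      "\<And>t. inverse (cmod (char (density lborel k) t)) \<le> C * exp (3 / (2 * \<gamma>) * \<bar>t\<bar> powr \<beta>)"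
      using Z.inverse_cmod_char_le_exponential[OF nz d0 \<beta> \<gamma> ev] by auto
    define c where "c = (4 / \<gamma>) powr (1 / \<beta>)"
    have c: "c > 0" unfolding c_def using \<gamma> by simp
    \<comment> \<open>The bandwidth already supplies the exponent \<open>-1 / \<beta>\<close> of the
      logarithm; \<open>a\<close> is what the variance must still gain to match the squared
      bias.\<close>
    define a where "a = 2 * \<alpha> / \<beta>"
    have a: "a > 0" unfolding a_def using pos \<beta> by simp
    define A where "A = ((4 * a) powr (4 * a)) powr (1/4)"
    define C' where "C' = U\<^sup>2 * K\<^sub>\<Sigma> / 2 * c powr (2 * \<alpha> + 1) + U\<^sup>2 * J / 2 * (C\<^sup>2 * c * A)"
    have "C' > 0" unfolding C'_def A_def using pos c J0 C by (intro add_pos_nonneg mult_pos_pos) auto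
    moreover have "(SUP f\<in>Sobolev_class \<alpha> K\<^sub>\<Sigma>. SUP p\<in>{0..<1}.
        mse k \<phi>\<^sub>u n ((4 / \<gamma>) powr (1 / \<beta>) * ln (real n) powr (-1 / \<beta>)) p f)
      \<le> ennreal (C' * ln (real n) powr (-(2 * \<alpha> + 1) / \<beta>))" if n: "n \<ge> 2" for n :: nat
    proof -
      define l where "l = ln (real n)"
      have l: "l > 0" unfolding l_def using n by simp
      define g where "g = c * l powr (-1 / \<beta>)"
      have g: "g > 0" unfolding g_def using c l by simp
      \<comment> \<open>The constant 4 in the bandwidth gives
        \<open>(1 / g) powr \<beta> = \<gamma> * l / 4\<close>, and the rate
        \<open>3 / (2 * \<gamma>)\<close> turns this into \<open>3 / 8 * l\<close>. Hence
        \<open>B\<^sup>2\<close> is of order \<open>n powr (3/4)\<close>, leaving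
        \<open>n powr (-1/4)\<close> after division by \<open>n\<close>.\<close>
      define B where "B = C * exp (3 / 8 * l)"
      have g\<beta>: "(1 / g) powr \<beta> = \<gamma> * l / 4"
      proof -
        have "g powr \<beta> = 4 / \<gamma> * (1 / l)"
          unfolding g_def c_def using \<gamma> l \<beta> by (simp add: powr_mult powr_powr powr_neg_one)
        then show ?thesis using g by (simp add: powr_divide)
      qed
      have B: "inverse (cmod (char (density lborel k) t)) \<le> B" if t: "\<bar>t\<bar> \<le> 1 / g" for t
      proof -
        have "\<bar>t\<bar> powr \<beta> \<le> \<gamma> * l / 4"
          unfolding g\<beta>[symmetric] using t \<beta> by (intro powr_mono2) auto
        then have "3 / (2 * \<gamma>) * \<bar>t\<bar> powr \<beta> \<le> 3 / (2 * \<gamma>) * (\<gamma> * l / 4)"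
          using \<gamma> by (intro mult_left_mono) auto
        also have "\<dots> = 3 / 8 * l" using \<gamma> by simp
        finally show ?thesis
          unfolding B_def using C by (intro order_trans[OF C(2)] mult_left_mono) auto
      qed
      have "B\<^sup>2 / real n = C\<^sup>2 * real n powr (-1/4)"
      proof -
        have "(exp (3 / 8 * l))\<^sup>2 = real n powr (3/4)"
          using n by (simp add: powr_def l_def power2_eq_square exp_add[symmetric])
        moreover have "real n powr (3/4) / real n = real n powr (-1/4)"
          using n powr_diff[of "real n" "3/4" 1] by simp
        ultimately show ?thesis
          unfolding B_def power_mult_distrib by (metis times_divide_eq_right)
      qed
      also have "\<dots> \<le> C\<^sup>2 * (A * l powr (-a))"
        unfolding A_def l_def using n a by (intro mult_left_mono powr_minus_quarter_le_ln_powr) auto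
      finally have "g * (B\<^sup>2 / real n) \<le> g * (C\<^sup>2 * (A * l powr (-a)))"
        using g by (intro mult_left_mono) auto
      also have "\<dots> = C\<^sup>2 * c * A * l powr (-(2 * \<alpha> + 1) / \<beta>)"
      proof -
        have "-(2 * \<alpha> + 1) / \<beta> = -1 / \<beta> + -a"
          unfolding a_def using \<beta> by (simp add: field_simps)
        then have "l powr (-(2 * \<alpha> + 1) / \<beta>) = l powr (-1 / \<beta>) * l powr (-a)"
          by (simp only: powr_add)
        then show ?thesis by (simp only: g_def mult_ac)
      qed
      finally have var: "g * B\<^sup>2 / real n \<le> C\<^sup>2 * c * A * l powr (-(2 * \<alpha> + 1) / \<beta>)" by simp
      have bias: "g powr (2 * \<alpha> + 1) = c powr (2 * \<alpha> + 1) * l powr (-(2 * \<alpha> + 1) / \<beta>)"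
      proof -
        have "-1 / \<beta> * (2 * \<alpha> + 1) = -(2 * \<alpha> + 1) / \<beta>"
          by (simp only: times_divide_eq_left mult_minus1)
        then show ?thesis unfolding g_def powr_mult powr_powr by (simp only:)
      qed
      have "U\<^sup>2 * K\<^sub>\<Sigma> / 2 * g powr (2 * \<alpha> + 1) + U\<^sup>2 * J / 2 * (g * B\<^sup>2 / real n) \<le>
          C' * l powr (-(2 * \<alpha> + 1) / \<beta>)"
        using mult_left_mono[OF var, of "U\<^sup>2 * J / 2"] J0
        unfolding C'_def bias by (simp add: distrib_right mult.assoc)
      from risk[OF _ g B] n order_trans[OF _ ennreal_leI[OF this]]
      have "(SUP f\<in>Sobolev_class \<alpha> K\<^sub>\<Sigma>. SUP p\<in>{0..<1}. mse k \<phi>\<^sub>u n g p f) \<le>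
          ennreal (C' * l powr (-(2 * \<alpha> + 1) / \<beta>))" by simp
      then show ?thesis unfolding g_def c_def l_def .
    qed
    ultimately show "\<exists>C>0. \<forall>n\<ge>2. (SUP f\<in>Sobolev_class \<alpha> K\<^sub>\<Sigma>. SUP p\<in>{0..<1}.
        mse k \<phi>\<^sub>u n ((4 / \<gamma>) powr (1 / \<beta>) * ln (real n) powr (-1 / \<beta>)) p f)
      \<le> ennreal (C * ln (real n) powr (-(2 * \<alpha> + 1) / \<beta>))"
      by blast
  qed
qed

end
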